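(* For every $r\in\mathbb N$ and every well-founded infinitary term $M$ (in any context and of any type), $$\rho(P_rM)\le2^{\rho(M)}.$$
   Context: Ordinals are classical with ordinary ordinal arithmetic and exponentiation; $\vee$ is binary supremum. **Infinitary (auxiliary) terms.** Simple types: $\sigma,\tau::=\iota\mid\sigma\to\tau$. Typed terms in contexts are inductively generated (well-founded, possibly countably branching), up to renaming of bound variables, by variables, abstraction $\lambda x^\sigma.M$, application with the usual typing, literals $\Gamma\vdash\underline n:\iota$ ($n\in\mathbb N$), queries $\Gamma\vdash\mathsf{query}_i(n\mapsto M_n):\iota$ ($i\in\mathbb N$, $\Gamma\vdash M_n:\iota$ for all $n\in\mathbb N$), and selections $\Gamma\vdash\mathsf{case}(M;\,n\mapsto M_n):\iota$ ($\Gamma\vdash M:\iota$, $\Gamma\vdash M_n:\iota$ for all $n$). Capture-avoiding substitution extends to selectors and all branches. **Rank.** $\rho(x)=\rho(\underline n)=0$; $\rho(\lambda x^\sigma.M)=\rho(M)+1$; $\rho(F\,V)=(\rho(F)\vee\rho(V))+1$; $\rho(\mathsf{query}_i(n\mapsto M_n))=(\sup_n\rho(M_n))+1$; $\rho(\mathsf{case}(M;n\mapsto M_n))=(\rho(M)\vee\sup_n\rho(M_n))+1$. **Passes.** $\mathrm{lev}(\iota)=0$, $\mathrm{lev}(\sigma\to\tau)=\max\{\mathrm{lev}(\sigma)+1,\mathrm{lev}(\tau)\}$. For $r\in\mathbb N$, $P_r$ is defined by structural recursion: it fixes variables and literals; $P_r(\lambda x^\sigma.M)=\lambda x^\sigma.P_rM$;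 $P_r(\mathsf{query}_i(n\mapsto M_n))=\mathsf{query}_i(n\mapsto P_rM_n)$; $P_r(\mathsf{case}(M;n\mapsto M_n))=\mathsf{case}(P_rM;n\mapsto P_rM_n)$; and for $F:\sigma\to\tau$, with $F'=P_rF$, $V'=P_rV$: $P_r(F\,V)=U'[V'/x]$ if $F'=\lambda x^\sigma.U'$ and $\mathrm{lev}(\sigma\to\tau)=r$, and $P_r(F\,V)=F'\,V'$ otherwise. *)

theory Defs
  imports "HOL-Library.Countable_Set_Type"
begin

unbundle cardinal_syntax

section \<open>Countable ordinals\<close>

text \<open>
  The ordinals are taken below the first uncountable ordinal, represented by the well-order
  \<^term>\<open>cardSuc natLeq\<close>. Terms branch at most countably, so their ranks, and the powers of two
  of their ranks, are all countable ordinals; countable sets of countable ordinals are bounded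
  (lemma \<open>bdd_above_countable\<close> below), so all suprema taken below are genuine.
\<close>

typedef ordinal = "Field (cardSuc natLeq)"
proof -
  have "\<not> finite (Field (cardSuc natLeq))"
    using cardSuc_finite[OF natLeq_Card_order] by (simp add: Field_natLeq)
  then show ?thesis unfolding ex_in_conv by auto
qed

abbreviation omega1 :: "nat set rel" where "omega1 \<equiv> cardSuc natLeq"

lemma Card_order_omega1: "Card_order omega1"
  by (rule cardSuc_Card_order[OF natLeq_Card_order])

lemma Well_order_omega1: "Well_order omega1"
  using Card_order_omega1 card_order_on_well_order_on by blast

instantiation ordinal :: wellorder
begin

definition less_eq_ordinal :: "ordinal \<Rightarrow> ordinal \<Rightarrow> bool" where
  "a \<le> b \<longleftrightarrow> (Rep_ordinal a, Rep_ordinal b) \<in> omega1"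

definition less_ordinal :: "ordinal \<Rightarrow> ordinal \<Rightarrow> bool" where
  "(a::ordinal) < b \<longleftrightarrow> a \<le> b \<and> a \<noteq> b"

instance
proof
  note wo = Well_order_omega1
  have refl: "refl_on (Field omega1) omega1" and tr: "trans omega1"
    and anti: "antisym omega1" and tot: "total_on (Field omega1) omega1"
    and wf: "wf (omega1 - Id)"
    using wo by (auto simp: well_order_on_def linear_order_on_def partial_order_on_def
        preorder_on_def)
  fix a b c :: ordinal
  show as: "a \<le> b \<Longrightarrow> b \<le> a \<Longrightarrow> a = b" for a b :: ordinal
    using anti unfolding less_eq_ordinal_def
    by (metis Rep_ordinal_inject antisymD)
  show "a < b \<longleftrightarrow> a \<le> b \<and> \<not> b \<le> a"
    using as refl unfolding less_ordinal_def
    by (metis less_eq_ordinal_def Rep_ordinal refl_onD)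
  show "a \<le> a"
    using refl Rep_ordinal unfolding less_eq_ordinal_def by (metis refl_onD)
  show "a \<le> b \<Longrightarrow> b \<le> c \<Longrightarrow> a \<le> c"
    using tr unfolding less_eq_ordinal_def by (metis transD)
  show "a \<le> b \<or> b \<le> a"
    using tot refl Rep_ordinal[of a] Rep_ordinal[of b] unfolding less_eq_ordinal_def total_on_def
    by (metis refl_onD)
  fix P :: "ordinal \<Rightarrow> bool" and a
  assume step: "\<And>x. (\<And>y. y < x \<Longrightarrow> P y) \<Longrightarrow> P x"
  have "wf (inv_image (omega1 - Id) Rep_ordinal)"
    using wf by (rule wf_inv_image)
  then show "P a"
  proof (induction a rule: wf_induct_rule)
    case (less x)
    show ?case
      by (rule step, rule less) (auto simp: less_ordinal_def less_eq_ordinal_def Rep_ordinal_inject)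
  qed
qed

end

lemma countable_lessThan_ordinal: "countable {..<(a::ordinal)}"
proof -
  have "|underS omega1 (Rep_ordinal a)| \<le>o natLeq"
    using card_of_underS[OF Card_order_omega1 Rep_ordinal]
      cardSuc_ordLeq_ordLess[OF natLeq_Card_order card_of_Card_order] by blast
  then have "countable (underS omega1 (Rep_ordinal a))"
    by (simp add: countable_card_le_natLeq)
  moreover have "Rep_ordinal ` {..<a} \<subseteq> underS omega1 (Rep_ordinal a)"
    by (auto simp: underS_def less_ordinal_def less_eq_ordinal_def Rep_ordinal_inject)
  ultimately have "countable (Rep_ordinal ` {..<a})"
    by (rule countable_subset[rotated])
  then show ?thesis
    using countable_image_inj_on[of Rep_ordinal] Rep_ordinal_inject by (metis inj_onI)
qed

lemma uncountable_ordinal: "\<not> countable (UNIV :: ordinal set)"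
proof
  assume "countable (UNIV :: ordinal set)"
  then have "countable (range Rep_ordinal)" by (rule countable_image)
  then have "|Field omega1| \<le>o natLeq"
    by (simp add: countable_card_le_natLeq type_definition.Rep_range[OF type_definition_ordinal])
  then have "omega1 \<le>o natLeq"
    using card_of_Field_ordIso[OF Card_order_omega1] ordIso_symmetric ordIso_ordLeq_trans by blast
  then show False
    using cardSuc_greater[OF natLeq_Card_order] not_ordLess_ordLeq by blast
qed

lemma ex_greater_countable:
  assumes "countable (A :: ordinal set)"
  shows "\<exists>b. \<forall>a\<in>A. a < b"
proof (rule ccontr)
  assume "\<not> ?thesis"
  then have "UNIV = (\<Union>a\<in>A. insert a {..<a})"
    by (auto simp: not_less order_le_less)
  moreover have "countable (\<Union>a\<in>A. insert a {..<a})"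
    using assms countable_lessThan_ordinal by (intro countable_UN) auto
  ultimately show False using uncountable_ordinal by simp
qed

lemma bdd_above_countable: "countable (A :: ordinal set) \<Longrightarrow> bdd_above A"
  using ex_greater_countable[of A] by (meson bdd_above.I less_imp_le)

instantiation ordinal :: conditionally_complete_linorder
begin

definition sup_ordinal :: "ordinal \<Rightarrow> ordinal \<Rightarrow> ordinal" where "sup_ordinal = max"
definition inf_ordinal :: "ordinal \<Rightarrow> ordinal \<Rightarrow> ordinal" where "inf_ordinal = min"
definition Sup_ordinal :: "ordinal set \<Rightarrow> ordinal" where "Sup A = (LEAST u :: ordinal. \<forall>a\<in>A. a \<le> u)"
definition Inf_ordinal :: "ordinal set \<Rightarrow> ordinal" where "Inf A = (LEAST a :: ordinal. a \<in> A)"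

instance
proof
  fix a z :: ordinal and A
  show "a \<in> A \<Longrightarrow> Inf A \<le> a"
    unfolding Inf_ordinal_def by (rule Least_le)
  show "A \<noteq> {} \<Longrightarrow> (\<And>x. x \<in> A \<Longrightarrow> z \<le> x) \<Longrightarrow> z \<le> Inf A"
    unfolding Inf_ordinal_def by (metis LeastI ex_in_conv)
  show "a \<in> A \<Longrightarrow> bdd_above A \<Longrightarrow> a \<le> Sup A"
    unfolding Sup_ordinal_def bdd_above_def
    by (elim exE) (drule LeastI[where P = "\<lambda>u. \<forall>a\<in>A. a \<le> u"], blast)
  show "A \<noteq> {} \<Longrightarrow> (\<And>x. x \<in> A \<Longrightarrow> x \<le> z) \<Longrightarrow> Sup A \<le> z"
    unfolding Sup_ordinal_def by (rule Least_le) blast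
qed (auto simp: sup_ordinal_def inf_ordinal_def)

end

lemma ordinal_le_SUP:
  fixes f :: "'a \<Rightarrow> ordinal"
  assumes "countable I" "i \<in> I"
  shows "f i \<le> (SUP i\<in>I. f i)"
  using assms by (intro cSUP_upper bdd_above_countable countable_image)

instantiation ordinal :: order_bot
begin
definition bot_ordinal :: ordinal where "bot = (LEAST a :: ordinal. True)"
instance by standard (simp add: bot_ordinal_def Least_le)
end

definition osuc :: "ordinal \<Rightarrow> ordinal" where
  "osuc a = (LEAST b. a < b)"

lemma less_osuc: "a < osuc a"
  unfolding osuc_def using ex_greater_countable[of "{a}"] by (auto intro: LeastI)

lemma osuc_le_iff: "osuc a \<le> b \<longleftrightarrow> a < b"
  using less_osuc[of a] by (auto simp: osuc_def intro: Least_le)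

lemma less_osuc_iff: "a < osuc b \<longleftrightarrow> a \<le> b"
  by (meson linorder_not_less osuc_le_iff)

lemma osuc_inject [simp]: "osuc a = osuc b \<longleftrightarrow> a = b"
  by (metis less_osuc less_osuc_iff order_antisym order_less_imp_le order_refl)

definition is_limit :: "ordinal \<Rightarrow> bool" where
  "is_limit b \<longleftrightarrow> b \<noteq> bot \<and> (\<forall>c. b \<noteq> osuc c)"

function ord_rec :: "ordinal \<Rightarrow> (ordinal \<Rightarrow> ordinal) \<Rightarrow> ordinal \<Rightarrow> ordinal" where
  "ord_rec z s b =
     (if b = bot then z
      else if \<exists>c. b = osuc c then s (ord_rec z s (THE c. b = osuc c))
      else (SUP c\<in>{..<b}. ord_rec z s c))"
  by pat_completeness auto
termination
  by (relation "inv_image {(x, y). x < y} (\<lambda>(z, s, b). b)")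
    (auto simp: less_osuc wf wf_inv_image)

declare ord_rec.simps [simp del]

lemma osuc_neq_bot [simp]: "osuc a \<noteq> bot"
  by (metis bot.extremum_strict less_osuc)

lemma ord_rec_bot: "ord_rec z s bot = z"
  by (simp add: ord_rec.simps)

lemma ord_rec_osuc: "ord_rec z s (osuc b) = s (ord_rec z s b)"
  by (subst ord_rec.simps) simp

lemma ord_rec_limit: "is_limit b \<Longrightarrow> ord_rec z s b = (SUP c\<in>{..<b}. ord_rec z s c)"
  by (subst ord_rec.simps) (simp add: is_limit_def)

lemma ordinal_induct [case_names zero suc limit]:
  assumes "P bot" "\<And>b. P b \<Longrightarrow> P (osuc b)"
    and "\<And>b. is_limit b \<Longrightarrow> (\<And>c. c < b \<Longrightarrow> P c) \<Longrightarrow> P b"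
  shows "P b"
proof (induction b rule: less_induct)
  case (less b)
  then show ?case using assms less_osuc by (cases "b = bot"; cases "\<exists>c. b = osuc c")
      (auto simp: is_limit_def)
qed

instantiation ordinal :: "{zero, one, plus, times}"
begin
definition zero_ordinal :: ordinal where "(0::ordinal) = bot"
definition one_ordinal :: ordinal where "(1::ordinal) = osuc 0"
definition plus_ordinal :: "ordinal \<Rightarrow> ordinal \<Rightarrow> ordinal" where
  "(a::ordinal) + b = ord_rec a osuc b"
definition times_ordinal :: "ordinal \<Rightarrow> ordinal \<Rightarrow> ordinal" where
  "(a::ordinal) * b = ord_rec 0 (\<lambda>x. x + a) b"
instance ..
end

text \<open>
  Ordinal exponentiation by the usual recursion; for base \<open>0\<close> it has value \<open>1\<close> at limit exponents.
\<close>

definition oexp :: "ordinal \<Rightarrow> ordinal \<Rightarrow> ordinal" where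
  "oexp a b = ord_rec 1 (\<lambda>x. x * a) b"

lemma add_zero_right: "a + 0 = (a::ordinal)"
  by (simp add: plus_ordinal_def zero_ordinal_def ord_rec_bot)

lemma add_osuc_right: "a + osuc b = osuc (a + b)"
  by (simp add: plus_ordinal_def ord_rec_osuc)

lemma add_limit_right: "is_limit b \<Longrightarrow> a + b = (SUP c\<in>{..<b}. a + c)"
  by (simp add: plus_ordinal_def ord_rec_limit)

lemma add_one_right: "a + 1 = osuc a"
  by (simp add: one_ordinal_def add_osuc_right add_zero_right)

lemma mult_zero_right_ordinal: "(a::ordinal) * 0 = 0"
  by (simp add: times_ordinal_def zero_ordinal_def ord_rec_bot)

lemma mult_osuc_right: "a * osuc b = a * b + a"
  by (simp add: times_ordinal_def ord_rec_osuc)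

lemma mult_limit_right: "is_limit b \<Longrightarrow> a * b = (SUP c\<in>{..<b}. a * c)"
  by (simp add: times_ordinal_def ord_rec_limit)

lemma oexp_zero_right: "oexp a 0 = 1"
  by (simp add: oexp_def zero_ordinal_def ord_rec_bot)

lemma oexp_osuc_right: "oexp a (osuc b) = oexp a b * a"
  by (simp add: oexp_def ord_rec_osuc)

lemma oexp_limit_right: "is_limit b \<Longrightarrow> oexp a b = (SUP c\<in>{..<b}. oexp a c)"
  by (simp add: oexp_def ord_rec_limit)

lemma add_mono_right_ordinal: "c \<le> b \<Longrightarrow> a + c \<le> a + (b::ordinal)"
proof (induction b rule: ordinal_induct)
  case zero
  then show ?case by (simp add: bot.extremum_unique)
next
  case (suc b)
  then show ?case
    by (metis add_osuc_right less_osuc less_osuc_iff order_le_less order_less_le_trans)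
next
  case (limit b)
  show ?case
  proof (cases "c = b")
    case False
    then have "c \<in> {..<b}" using limit.prems by auto
    then show ?thesis
      unfolding add_limit_right[OF limit.hyps]
      by (rule ordinal_le_SUP[OF countable_lessThan_ordinal])
  qed simp
qed

lemma add_strict_mono_right_ordinal: "c < b \<Longrightarrow> a + c < a + (b::ordinal)"
  by (metis add_mono_right_ordinal add_osuc_right osuc_le_iff)

lemma less_add_limitE:
  assumes "is_limit c" "e < b + c"
  obtains d where "d < c" "e < b + d"
proof -
  have "bot < c" using assms(1) by (simp add: is_limit_def bot.not_eq_extremum)
  then have "{..<c} \<noteq> {}" by auto
  then have "\<exists>d\<in>{..<c}. e < b + d"
    using assms unfolding add_limit_right[OF assms(1)]
    by (subst (asm) less_cSUP_iff)
      (auto intro!: bdd_above_countable countable_image countable_lessThan_ordinal)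
  then show thesis using that by auto
qed

lemma is_limit_add:
  assumes "is_limit c"
  shows "is_limit (b + c)"
proof -
  have "bot < c" using assms by (simp add: is_limit_def bot.not_eq_extremum)
  then have "b + bot < b + c" by (rule add_strict_mono_right_ordinal)
  then have "b + c \<noteq> bot" by auto
  moreover have False if "b + c = osuc e" for e
  proof -
    have "e < b + c" using that less_osuc by simp
    then obtain d where "d < c" "e < b + d" by (rule less_add_limitE[OF assms])
    then have "osuc e < b + c"
      by (meson add_strict_mono_right_ordinal order_le_less_trans osuc_le_iff)
    then show False using that by simp
  qed
  ultimately show ?thesis by (auto simp: is_limit_def)
qed

instance ordinal :: semigroup_add
proof
  fix a b c :: ordinal
  show "a + b + c = a + (b + c)"
  proof (induction c rule: ordinal_induct)
    case zero
    then show ?case by (simp flip: zero_ordinal_def add: add_zero_right)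
  next
    case (suc c)
    then show ?case by (simp add: add_osuc_right)
  next
    case (limit c)
    have ne: "{..<c} \<noteq> {}" "{..<b + c} \<noteq> {}"
      using limit.hyps is_limit_add[OF limit.hyps, of b]
      by (auto simp: is_limit_def bot.not_eq_extremum)
    have "a + b + c = (SUP d\<in>{..<c}. a + (b + d))"
      using limit by (simp add: add_limit_right)
    also have "\<dots> = (SUP e\<in>{..<b + c}. a + e)"
    proof (rule antisym)
      show "(SUP d\<in>{..<c}. a + (b + d)) \<le> (SUP e\<in>{..<b + c}. a + e)"
        by (rule cSUP_least[OF ne(1)])
          (auto intro!: ordinal_le_SUP countable_lessThan_ordinal add_strict_mono_right_ordinal)
      show "(SUP e\<in>{..<b + c}. a + e) \<le> (SUP d\<in>{..<c}. a + (b + d))"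
      proof (rule cSUP_least[OF ne(2)])
        fix e assume "e \<in> {..<b + c}"
        then obtain d where d: "d < c" "e < b + d"
          using less_add_limitE[OF limit.hyps] by auto
        then have "a + e \<le> a + (b + d)" by (simp add: add_mono_right_ordinal)
        also have "\<dots> \<le> (SUP d\<in>{..<c}. a + (b + d))"
          using d by (intro ordinal_le_SUP countable_lessThan_ordinal) auto
        finally show "a + e \<le> (SUP d\<in>{..<c}. a + (b + d))" .
      qed
    qed
    finally show ?case by (simp only: add_limit_right[OF is_limit_add[OF limit.hyps]])
  qed
qed

text \<open>Numerals for \<^typ>\<open>ordinal\<close> are thus available, with \<open>2 = 1 + 1\<close>.\<close>

instance ordinal :: numeral ..

lemma two_eq_osuc_osuc: "(2::ordinal) = osuc (osuc 0)"
proof -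
  have "(2::ordinal) = 1 + 1" by (rule one_add_one[symmetric])
  also have "\<dots> = osuc 1" by (rule add_one_right)
  finally show ?thesis by (simp only: one_ordinal_def)
qed


section \<open>Infinitary terms\<close>

datatype ty = Iota | Arr ty ty (infixr "\<rightarrow>" 65)

primrec lev :: "ty \<Rightarrow> nat" where
  "lev Iota = 0"
| "lev (\<sigma> \<rightarrow> \<tau>) = max (lev \<sigma> + 1) (lev \<tau>)"

text \<open>
  Terms up to renaming of bound variables are represented with de Bruijn indices. A context is a
  list of types, whose \<open>i\<close>th entry is the type of the variable with index \<open>i\<close>.
\<close>

datatype trm =
    Var nat
  | Lam ty trm
  | App trm trm
  | Lit nat
  | Query nat "nat \<Rightarrow> trm"
  | Case trm "nat \<Rightarrow> trm"

inductive has_type :: "ty list \<Rightarrow> trm \<Rightarrow> ty \<Rightarrow> bool" ("_ \<turnstile> _ : _" [50, 50, 50] 50) where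
  Var: "i < length \<Gamma> \<Longrightarrow> \<Gamma> \<turnstile> Var i : \<Gamma> ! i"
| Lam: "\<sigma> # \<Gamma> \<turnstile> M : \<tau> \<Longrightarrow> \<Gamma> \<turnstile> Lam \<sigma> M : \<sigma> \<rightarrow> \<tau>"
| App: "\<Gamma> \<turnstile> F : \<sigma> \<rightarrow> \<tau> \<Longrightarrow> \<Gamma> \<turnstile> V : \<sigma> \<Longrightarrow> \<Gamma> \<turnstile> App F V : \<tau>"
| Lit: "\<Gamma> \<turnstile> Lit n : Iota"
| Query: "(\<And>n. \<Gamma> \<turnstile> N n : Iota) \<Longrightarrow> \<Gamma> \<turnstile> Query i N : Iota"
| Case: "\<Gamma> \<turnstile> M : Iota \<Longrightarrow> (\<And>n. \<Gamma> \<turnstile> N n : Iota) \<Longrightarrow> \<Gamma> \<turnstile> Case M N : Iota"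

text \<open>\<open>lift M k\<close> increments the variables of \<open>M\<close> with index at least \<open>k\<close>.\<close>

primrec lift :: "trm \<Rightarrow> nat \<Rightarrow> trm" where
  "lift (Var i) k = (if i < k then Var i else Var (i + 1))"
| "lift (Lam \<sigma> M) k = Lam \<sigma> (lift M (k + 1))"
| "lift (App F V) k = App (lift F k) (lift V k)"
| "lift (Lit n) k = Lit n"
| "lift (Query i N) k = Query i (\<lambda>n. lift (N n) k)"
| "lift (Case M N) k = Case (lift M k) (\<lambda>n. lift (N n) k)"

text \<open>
  \<open>subst M V k\<close> replaces the variable with index \<open>k\<close> in \<open>M\<close> by \<open>V\<close> and removes it from the context.
\<close>

primrec subst :: "trm \<Rightarrow> trm \<Rightarrow> nat \<Rightarrow> trm" where
  "subst (Var i) V k = (if i < k then Var i else if i = k then V else Var (i - 1))"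
| "subst (Lam \<sigma> M) V k = Lam \<sigma> (subst M (lift V 0) (k + 1))"
| "subst (App F W) V k = App (subst F V k) (subst W V k)"
| "subst (Lit n) V k = Lit n"
| "subst (Query i N) V k = Query i (\<lambda>n. subst (N n) V k)"
| "subst (Case M N) V k = Case (subst M V k) (\<lambda>n. subst (N n) V k)"

primrec rank :: "trm \<Rightarrow> ordinal" where
  "rank (Var i) = 0"
| "rank (Lam \<sigma> M) = rank M + 1"
| "rank (App F V) = sup (rank F) (rank V) + 1"
| "rank (Lit n) = 0"
| "rank (Query i N) = (SUP n. rank (N n)) + 1"
| "rank (Case M N) = sup (rank M) (SUP n. rank (N n)) + 1"

text \<open>
  Whether an application is contracted depends on the type of its operator, so the pass takes the
  context of the term as an argument. Types are unique and preserved by passes (lemmas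
  \<open>has_type_unique\<close> and \<open>has_type_pass\<close> below), so if \<open>F\<close> of type \<open>\<sigma> \<rightarrow> \<tau>\<close> passes to
  \<open>Lam \<sigma>' U\<close> then \<open>\<sigma>' = \<sigma>\<close>.
\<close>

primrec pass :: "nat \<Rightarrow> ty list \<Rightarrow> trm \<Rightarrow> trm" where
  "pass r \<Gamma> (Var i) = Var i"
| "pass r \<Gamma> (Lam \<sigma> M) = Lam \<sigma> (pass r (\<sigma> # \<Gamma>) M)"
| "pass r \<Gamma> (App F V) =
    (case pass r \<Gamma> F of
       Lam \<sigma> U \<Rightarrow>
         if \<exists>\<tau>. \<Gamma> \<turnstile> F : \<sigma> \<rightarrow> \<tau> \<and> lev (\<sigma> \<rightarrow> \<tau>) = r then subst U (pass r \<Gamma> V) 0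
         else App (pass r \<Gamma> F) (pass r \<Gamma> V)
     | _ \<Rightarrow> App (pass r \<Gamma> F) (pass r \<Gamma> V))"
| "pass r \<Gamma> (Lit n) = Lit n"
| "pass r \<Gamma> (Query i N) = Query i (\<lambda>n. pass r \<Gamma> (N n))"
| "pass r \<Gamma> (Case M N) = Case (pass r \<Gamma> M) (\<lambda>n. pass r \<Gamma> (N n))"

inductive_cases has_type_VarE: "\<Gamma> \<turnstile> Var i : \<tau>"
inductive_cases has_type_LamE: "\<Gamma> \<turnstile> Lam \<sigma> M : \<tau>"
inductive_cases has_type_AppE: "\<Gamma> \<turnstile> App F V : \<tau>"
inductive_cases has_type_LitE: "\<Gamma> \<turnstile> Lit n : \<tau>"
inductive_cases has_type_QueryE: "\<Gamma> \<turnstile> Query i N : \<tau>"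
inductive_cases has_type_CaseE: "\<Gamma> \<turnstile> Case M N : \<tau>"
lemmas has_type_elims =
  has_type_VarE has_type_LamE has_type_AppE has_type_LitE has_type_QueryE has_type_CaseE

lemma has_type_unique: "\<Gamma> \<turnstile> M : \<sigma> \<Longrightarrow> \<Gamma> \<turnstile> M : \<tau> \<Longrightarrow> \<sigma> = \<tau>"
proof (induction arbitrary: \<tau> rule: has_type.induct)
  case (App \<Gamma> F \<sigma> \<tau>' V)
  then show ?case by (metis has_type_AppE ty.inject)
qed (blast elim: has_type_elims)+

lemma has_type_lift: "\<Gamma> @ \<Delta> \<turnstile> M : \<tau> \<Longrightarrow> \<Gamma> @ \<sigma> # \<Delta> \<turnstile> lift M (length \<Gamma>) : \<tau>"
proof (induction "\<Gamma> @ \<Delta>" M \<tau> arbitrary: \<Gamma> rule: has_type.induct)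
  case (Var i)
  then show ?case
    using has_type.Var[of i "\<Gamma> @ \<sigma> # \<Delta>"] has_type.Var[of "Suc i" "\<Gamma> @ \<sigma> # \<Delta>"]
    by (auto simp: nth_append Suc_diff_le)
next
  case (Lam \<sigma>' M \<tau>)
  from Lam(2)[of "\<sigma>' # \<Gamma>"] show ?case by (auto intro: has_type.Lam)
qed (auto intro: has_type.intros)

lemma has_type_subst:
  "\<Gamma> @ \<sigma> # \<Delta> \<turnstile> M : \<tau> \<Longrightarrow> \<Gamma> @ \<Delta> \<turnstile> V : \<sigma> \<Longrightarrow> \<Gamma> @ \<Delta> \<turnstile> subst M V (length \<Gamma>) : \<tau>"
proof (induction "\<Gamma> @ \<sigma> # \<Delta>" M \<tau> arbitrary: \<Gamma> V rule: has_type.induct)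
  case (Var i)
  consider "i < length \<Gamma>" | "i = length \<Gamma>" | j where "i = Suc j" "length \<Gamma> \<le> j"
    by (cases i) force+
  then show ?case
  proof cases
    case 3
    then show ?thesis
      using Var has_type.Var[of j "\<Gamma> @ \<Delta>"] by (simp add: nth_append Suc_diff_le)
  qed (use Var has_type.Var[of i "\<Gamma> @ \<Delta>"] in \<open>simp_all add: nth_append\<close>)
next
  case (Lam \<sigma>' M \<tau>)
  from Lam(2)[of "\<sigma>' # \<Gamma>" "lift V 0"] has_type_lift[of "[]" "\<Gamma> @ \<Delta>" V \<sigma> \<sigma>'] Lam(3)
  show ?case by (auto intro: has_type.Lam)
qed (auto intro: has_type.intros)

lemma has_type_pass: "\<Gamma> \<turnstile> M : \<tau> \<Longrightarrow> \<Gamma> \<turnstile> pass r \<Gamma> M : \<tau>"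
proof (induction rule: has_type.induct)
  case (App \<Gamma> F \<sigma> \<tau> V)
  have app: "\<Gamma> \<turnstile> App (pass r \<Gamma> F) (pass r \<Gamma> V) : \<tau>"
    using App.IH by (rule has_type.App)
  have sub: "\<Gamma> \<turnstile> subst U (pass r \<Gamma> V) 0 : \<tau>" if "pass r \<Gamma> F = Lam \<sigma>' U" for \<sigma>' U
  proof -
    have "\<sigma> # \<Gamma> \<turnstile> U : \<tau>"
      using App.IH(1) that by (auto elim: has_type_LamE)
    then show ?thesis
      using has_type_subst[of "[]" \<sigma> \<Gamma> U \<tau> "pass r \<Gamma> V"] App.IH(2) by simp
  qed
  show ?case
    using app sub by (cases "pass r \<Gamma> F") auto
qed (auto intro: has_type.intros)

end

theory Submission
  imports Defs
begin

text \<open>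
  Substitution satisfies \<open>\<rho>(U[V/x]) \<le> \<rho>(V) + \<rho>(U)\<close>, with \<open>\<rho>(V)\<close> on the left, so that the
  successors taken along \<open>U\<close> act on the right of the sum. If both parts of an application have
  passes of rank at most \<open>2\<^sup>\<alpha>\<close>, its contraction therefore has rank at most
  \<open>2\<^sup>\<alpha> + 2\<^sup>\<alpha> = 2\<^bsup>\<alpha> + 1\<^esup>\<close>; in all other cases \<open>2\<^sup>\<alpha> + 1 \<le> 2\<^bsup>\<alpha> + 1\<^esup>\<close> suffices.
\<close>

lemma zero_le_ordinal [simp]: "0 \<le> (a::ordinal)"
  by (simp add: zero_ordinal_def)

lemma osuc_mono: "a \<le> b \<Longrightarrow> osuc a \<le> osuc b"
  by (simp add: osuc_le_iff less_osuc_iff)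

lemma SUP_lessThan_limit_le:
  fixes f :: "ordinal \<Rightarrow> ordinal"
  assumes "is_limit b" "\<And>c. c < b \<Longrightarrow> f c \<le> z"
  shows "(SUP c\<in>{..<b}. f c) \<le> z"
proof -
  \<comment> \<open>\<open>cSUP_least\<close> needs a nonempty index set: a limit differs from
    \<open>bot\<close>, so \<open>bot\<close> lies below it.\<close>
  have "bot \<in> {..<b}" using assms(1) by (simp add: is_limit_def bot.not_eq_extremum)
  then show ?thesis using assms(2) by (intro cSUP_least) auto
qed

text \<open>Only the weak form holds on this side: 0 + omega = 1 + omega.\<close>

lemma add_mono_left_ordinal: "a \<le> b \<Longrightarrow> a + c \<le> b + (c::ordinal)"
proof (induction c rule: ordinal_induct)
  case zero
  then show ?case by (simp flip: zero_ordinal_def add: add_zero_right)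
next
  case (suc c)
  then show ?case by (simp add: add_osuc_right osuc_mono)
next
  case (limit c)
  then show ?case
    by (subst add_limit_right, simp)
      (meson SUP_lessThan_limit_le add_mono_right_ordinal order_less_imp_le order_trans)
qed

lemma add_mono_ordinal: "a \<le> b \<Longrightarrow> c \<le> d \<Longrightarrow> a + c \<le> b + (d::ordinal)"
  by (meson add_mono_left_ordinal add_mono_right_ordinal order_trans)

lemma le_add_right_ordinal: "a \<le> a + (b::ordinal)"
  using add_mono_right_ordinal[of 0 b a] by (simp add: add_zero_right)

lemma le_add_left_ordinal: "b \<le> a + (b::ordinal)"
proof (induction b rule: less_induct)
  case (less b)
  show ?case
  proof (rule ccontr)
    assume "\<not> b \<le> a + b"
    then have "a + b < b" by simp
    \<comment> \<open>For c = a + b, the induction hypothesis gives c \<le> a + c, while adding a on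
      the left of c < b gives a + c < c.\<close>
    with less.IH[OF this] add_strict_mono_right_ordinal[OF this, of a] show False by simp
  qed
qed

lemma add_zero_left: "0 + a = (a::ordinal)"
proof (rule antisym)
  show "0 + a \<le> a"
  proof (induction a rule: ordinal_induct)
    case zero
    then show ?case by (simp flip: zero_ordinal_def add: add_zero_right)
  next
    case (suc a)
    then show ?case by (simp add: add_osuc_right osuc_mono)
  next
    case (limit a)
    then show ?case
      by (subst add_limit_right, simp) (meson SUP_lessThan_limit_le order_less_imp_le order_trans)
  qed
qed (rule le_add_left_ordinal)

text \<open>Multiplication recurses on its right factor, so x * 2 unfolds to (0 + x) + x;
  \<open>add_zero_left\<close> removes the 0.\<close>

lemma oexp_two_osuc: "oexp 2 (osuc a) = oexp 2 a + oexp 2 a"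
  by (simp only: oexp_osuc_right two_eq_osuc_osuc mult_osuc_right mult_zero_right_ordinal
      add_zero_left)

lemma oexp_two_mono: "a \<le> b \<Longrightarrow> oexp 2 a \<le> oexp 2 b"
proof (induction b rule: ordinal_induct)
  case zero
  then show ?case by (simp add: bot.extremum_unique)
next
  case (suc b)
  show ?case
  proof (cases "a = osuc b")
    case False
    then have "oexp 2 a \<le> oexp 2 b"
      using suc less_osuc_iff by (metis order_le_less)
    then show ?thesis
      unfolding oexp_two_osuc using le_add_right_ordinal by (rule order_trans)
  qed simp
next
  case (limit b)
  show ?case
  proof (cases "a = b")
    case False
    then have "a \<in> {..<b}" using limit.prems by auto
    then show ?thesis
      unfolding oexp_limit_right[OF limit.hyps]
      by (rule ordinal_le_SUP[OF countable_lessThan_ordinal])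
  qed simp
qed

lemma one_le_oexp_two: "1 \<le> oexp 2 a"
  using oexp_two_mono[of 0 a] by (simp add: oexp_zero_right)

text \<open>Absorbs the successor contributed by a constructor that survives the pass: doubling
  \<open>oexp 2 b\<close> adds at least 1.\<close>

lemma osuc_le_oexp_two_osuc: "a \<le> oexp 2 b \<Longrightarrow> osuc a \<le> oexp 2 (osuc b)"
  using add_mono_ordinal[OF _ one_le_oexp_two, of a "oexp 2 b" b]
  by (simp add: oexp_two_osuc add_one_right)

lemma rank_le_SUP: "rank (N n) \<le> (SUP n::nat. rank (N n))"
  by (rule ordinal_le_SUP) auto

lemma rank_lift [simp]: "rank (lift M k) = rank M"
  by (induction M arbitrary: k) auto

lemma rank_subst: "rank (subst M V k) \<le> rank V + rank M"
\<comment> \<open>\<open>V\<close> varies because it is lifted under each binder;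
  \<open>rank_lift\<close> keeps its rank fixed.\<close>
proof (induction M arbitrary: V k)
  case (Var i)
  then show ?case by (simp add: add_zero_right)
next
  case (Lam \<sigma> M)
  show ?case
    using Lam.IH[of "lift V 0" "k + 1"] by (simp add: add_one_right add_osuc_right osuc_mono)
next
  case (App F W)
  have "rank (subst F V k) \<le> rank V + sup (rank F) (rank W)"
    by (rule order_trans[OF App.IH(1)]) (simp add: add_mono_right_ordinal)
  moreover have "rank (subst W V k) \<le> rank V + sup (rank F) (rank W)"
    by (rule order_trans[OF App.IH(2)]) (simp add: add_mono_right_ordinal)
  ultimately show ?case by (simp add: add_one_right add_osuc_right osuc_mono)
next
  case (Lit n)
  then show ?case by simp
next
  case (Query i N)
  have "(SUP n. rank (subst (N n) V k)) \<le> rank V + (SUP n. rank (N n))"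
    by (rule cSUP_least) (auto intro: order_trans[OF Query.IH] add_mono_right_ordinal rank_le_SUP)
  then show ?case by (simp add: add_one_right add_osuc_right osuc_mono)
next
  case (Case M N)
  have "rank (subst M V k) \<le> rank V + sup (rank M) (SUP n. rank (N n))"
    by (rule order_trans[OF Case.IH(1)]) (simp add: add_mono_right_ordinal)
  moreover have "(SUP n. rank (subst (N n) V k)) \<le> rank V + sup (rank M) (SUP n. rank (N n))"
    by (rule cSUP_least)
      (auto intro!: order_trans[OF Case.IH(2)] add_mono_right_ordinal le_supI2 rank_le_SUP)
  ultimately show ?case by (simp add: add_one_right add_osuc_right osuc_mono)
qed

theorem lemma10:
  fixes r :: nat and \<Gamma> :: "ty list" and M :: trm and \<tau> :: ty
  assumes "\<Gamma> \<turnstile> M : \<tau>"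
  shows "rank (pass r \<Gamma> M) \<le> oexp 2 (rank M)"
\<comment> \<open>The context varies because the pass extends it under a binder.\<close>
proof (induction M arbitrary: \<Gamma>)
  case (Var i)
  then show ?case by simp
next
  case (Lam \<sigma> M)
  then show ?case by (simp add: add_one_right osuc_le_oexp_two_osuc)
next
  case (App F V)
  let ?\<alpha> = "sup (rank F) (rank V)"
  have F: "rank (pass r \<Gamma> F) \<le> oexp 2 ?\<alpha>" and V: "rank (pass r \<Gamma> V) \<le> oexp 2 ?\<alpha>"
    using App.IH oexp_two_mono by (meson order_trans sup_ge1 sup_ge2)+
  have app: "rank (App (pass r \<Gamma> F) (pass r \<Gamma> V)) \<le> oexp 2 (osuc ?\<alpha>)"
    using F V by (simp add: add_one_right osuc_le_oexp_two_osuc)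
  have sub: "rank (subst U (pass r \<Gamma> V) 0) \<le> oexp 2 (osuc ?\<alpha>)" if "pass r \<Gamma> F = Lam \<sigma> U" for \<sigma> U
  proof -
    \<comment> \<open>\<open>U\<close> has smaller rank than the abstraction
      \<open>Lam \<sigma> U\<close>, which \<open>F\<close> bounds.\<close>
    have "rank U \<le> oexp 2 ?\<alpha>"
      using F that by (simp add: add_one_right osuc_le_iff)
    with V have "rank (pass r \<Gamma> V) + rank U \<le> oexp 2 (osuc ?\<alpha>)"
      unfolding oexp_two_osuc by (rule add_mono_ordinal)
    with rank_subst show ?thesis by (rule order_trans)
  qed
  show ?case
    \<comment> \<open>\<open>app\<close> and \<open>sub\<close> cover both outcomes of the type and
      level test.\<close>
    using app sub by (cases "pass r \<Gamma> F") (auto simp: add_one_right)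
next
  case (Lit n)
  then show ?case by simp
next
  case (Query i N)
  have "(SUP n. rank (pass r \<Gamma> (N n))) \<le> oexp 2 (SUP n. rank (N n))"
    by (rule cSUP_least) (auto intro: order_trans[OF Query.IH] oexp_two_mono rank_le_SUP)
  then show ?case by (simp add: add_one_right osuc_le_oexp_two_osuc)
next
  case (Case M N)
  let ?\<alpha> = "sup (rank M) (SUP n. rank (N n))"
  have "rank (pass r \<Gamma> M) \<le> oexp 2 ?\<alpha>"
    by (rule order_trans[OF Case.IH(1)]) (simp add: oexp_two_mono)
  moreover have "(SUP n. rank (pass r \<Gamma> (N n))) \<le> oexp 2 ?\<alpha>"
    by (rule cSUP_least)
      (auto intro!: order_trans[OF Case.IH(2)] oexp_two_mono le_supI2 rank_le_SUP)
  ultimately show ?case by (simp add: add_one_right osuc_le_oexp_two_osuc)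
qed

end
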